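(* Let $x$ be any sequence of signs $\pm1$ of length $a$, and let $P_x$ be the distribution on $S_n$ of an $x$-shuffle of $n$ cards. Then \[ \operatorname{sep}(P_x)\le 1-\prod_{i=1}^{n-1}\left(1-\frac{i}{a}\right). \]
   Context: For a sign sequence $x=(x_1,\dots,x_a)$, the $x$-shuffle of a deck of $n$ cards is: cut the deck, from the top, into $a$ consecutive packets with multinomial sizes (as $n$ balls dropped independently and uniformly into $a$ boxes), reverse packet $i$ whenever $x_i=-1$, then interleave the packets so that all interleavings preserving order within each packet are equally likely; $P_x$ is the resulting distribution on $S_n$. For a probability $P$ on $S_n$ with $U$ the uniform distribution, the separation distance is $\operatorname{sep}(P)=\max_{w\in S_n}\left(1-\frac{P(w)}{U(w)}\right)$. *)

theory Defs
  imports "HOL-Probability.Probability" "HOL-Probability.Product_PMF"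
    "HOL-Combinatorics.Permutations" "HOL-Library.Sublist"
begin

definition perms :: "nat \<Rightarrow> (nat \<Rightarrow> nat) set" where
  "perms n = {w. w permutes {..<n}}"

definition uniform_perm :: "nat \<Rightarrow> (nat \<Rightarrow> nat) pmf" where
  "uniform_perm n = pmf_of_set (perms n)"

text \<open>\<open>P\<close> is meant to be supported on \<open>perms n\<close>.\<close>
definition sep :: "nat \<Rightarrow> (nat \<Rightarrow> nat) pmf \<Rightarrow> real" where
  "sep n P = Max ((\<lambda>w. 1 - pmf P w / pmf (uniform_perm n) w) ` perms n)"

text \<open>Decks are lists whose head is the top card.\<close>

fun cut_deck :: "nat list \<Rightarrow> 'c list \<Rightarrow> 'c list list" where
  "cut_deck [] deck = []"
| "cut_deck (m # ms) deck = take m deck # cut_deck ms (drop m deck)"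

definition packet_sizes :: "nat \<Rightarrow> nat \<Rightarrow> nat list pmf" where
  "packet_sizes a n =
     map_pmf (\<lambda>box. map (\<lambda>i. card {ball \<in> {..<n}. box ball = i}) [0..<a])
       (Pi_pmf {..<n} 0 (\<lambda>_. pmf_of_set {..<a}))"

definition orient :: "int \<Rightarrow> 'c list \<Rightarrow> 'c list" where
  "orient s p = (if s = -1 then rev p else p)"

text \<open>
  Interleavings are identified with the resulting decks. This is only adequate when all cards
  in the packets are distinct, which is the case in \<open>x_shuffle\<close>.
\<close>
definition interleavings :: "'c list list \<Rightarrow> 'c list set" where
  "interleavings ps = {deck. mset deck = mset (concat ps) \<and> (\<forall>p \<in> set ps. subseq p deck)}"

text \<open>
  A deck of the cards \<open>0, \<dots>, n - 1\<close> is read as the permutation sending a position to the card at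
  that position. The opposite convention replaces \<open>w\<close> by its inverse, which does not affect \<open>sep\<close>.
\<close>
definition perm_of_deck :: "nat list \<Rightarrow> nat \<Rightarrow> nat" where
  "perm_of_deck deck = (\<lambda>j. if j < length deck then deck ! j else j)"

definition x_shuffle :: "int list \<Rightarrow> nat \<Rightarrow> (nat \<Rightarrow> nat) pmf" where
  "x_shuffle x n =
     do {
       sizes \<leftarrow> packet_sizes (length x) n;
       deck \<leftarrow> pmf_of_set (interleavings (map2 orient x (cut_deck sizes [0..<n])));
       return_pmf (perm_of_deck deck)
     }"

end

theory Submission
  imports Defs "HOL-Combinatorics.Multiset_Permutations"
begin

text \<open>
  If the \<open>n\<close> balls fall into distinct boxes then every packet has at most one card: the
  reversals have no effect and all \<open>n!\<close> decks are equally likely. Hence \<open>P\<^sub>x(w) / U(w)\<close> is at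
  least the probability of this event, which is the product in the birthday problem.
\<close>

text \<open>The size hypothesis ensures that no cards are left when the sizes run out;
  \<open>cut_deck []\<close> would discard them.\<close>

lemma concat_cut_deck:
  "length deck \<le> sum_list ms \<Longrightarrow> concat (cut_deck ms deck) = deck"
  by (induction ms deck rule: cut_deck.induct) auto

lemma length_cut_deck [simp]: "length (cut_deck ms deck) = length ms"
  by (induction ms deck rule: cut_deck.induct) auto

lemma length_packet_le:
  "(\<And>m. m \<in> set ms \<Longrightarrow> m \<le> k) \<Longrightarrow> p \<in> set (cut_deck ms deck) \<Longrightarrow> length p \<le> k"
  by (induction ms deck rule: cut_deck.induct) (auto simp: min_le_iff_disj)

lemma orient_short: "length p \<le> 1 \<Longrightarrow> orient s p = p"
  by (cases p) (auto simp: orient_def)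

lemma map2_orient_short:
  assumes "length x = length ps" "\<And>p. p \<in> set ps \<Longrightarrow> length p \<le> 1"
  shows   "map2 orient x ps = ps"
  using assms by (induction x ps rule: list_induct2) (auto simp: orient_short)

lemma subseq_singleton_left_iff: "subseq [c] ys \<longleftrightarrow> c \<in> set ys"
  by (induction ys) auto

text \<open>An empty or one-card packet carries no order: being a subsequence of the deck then only
  means membership, which the equality of multisets already gives.\<close>

lemma interleavings_short:
  assumes "\<And>p. p \<in> set ps \<Longrightarrow> length p \<le> 1"
  shows   "interleavings ps = {deck. mset deck = mset (concat ps)}"
proof -
  have "subseq p deck" if deck: "mset deck = mset (concat ps)" and p: "p \<in> set ps" for deck p
  proof -
    have "set p \<subseteq> set deck"
      using mset_eq_setD[OF deck] p by auto
    moreover have "p = [] \<or> (\<exists>c. p = [c])"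
      using assms[OF p] by (cases p) auto
    ultimately show ?thesis
      by (auto simp: subseq_singleton_left_iff)
  qed
  then show ?thesis
    by (auto simp: interleavings_def)
qed

lemma interleavings_singletons:
  assumes "length x = length sizes" "sum_list sizes = n" "\<And>m. m \<in> set sizes \<Longrightarrow> m \<le> 1"
  shows   "interleavings (map2 orient x (cut_deck sizes [0..<n])) = permutations_of_set {..<n}"
proof -
  let ?ps = "cut_deck sizes [0..<n]"
  have short: "length p \<le> 1" if "p \<in> set ?ps" for p
    using length_packet_le[OF assms(3) that] .
  have "map2 orient x ?ps = ?ps"
    using assms(1) short by (intro map2_orient_short) auto
  moreover have "concat ?ps = [0..<n]"
    using assms(2) by (intro concat_cut_deck) auto
  ultimately have "interleavings (map2 orient x ?ps) = {deck. mset deck = mset [0..<n]}"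
    using interleavings_short[OF short] by simp
  \<comment> \<open>The cards in \<open>[0..<n]\<close> are distinct, so its multiset is that of the
    set and the decks are exactly the orderings of \<open>{..<n}\<close>.\<close>
  also have "\<dots> = permutations_of_multiset (mset_set {..<n})"
    by (simp add: permutations_of_multiset_def lessThan_atLeast0)
  also have "\<dots> = permutations_of_set {..<n}"
    by (simp add: permutations_of_set_altdef)
  finally show ?thesis .
qed

lemma card_fibre_le_1:
  assumes "inj_on f A"
  shows   "card {b \<in> A. f b = i} \<le> 1"
proof (cases "\<exists>b \<in> A. f b = i")
  case True
  then obtain b where "b \<in> A" "f b = i" by blast
  then have "{b \<in> A. f b = i} = {b}"
    using assms by (auto simp: inj_on_def)
  then show ?thesis by simp
next
  case False
  then have "{b \<in> A. f b = i} = {}" by blast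
  then show ?thesis by (simp only: card.empty)
qed

text \<open>The fibres over the boxes partition \<open>A\<close>. With balls in place of
  \<open>A\<close>, the packet sizes add up to \<open>n\<close>, so the cut uses up the
  deck.\<close>

lemma sum_card_fibres:
  assumes "finite A" "f ` A \<subseteq> {..<a::nat}"
  shows   "(\<Sum>i\<leftarrow>[0..<a]. card {b \<in> A. f b = i}) = card A"
proof -
  have "(\<Sum>i\<leftarrow>[0..<a]. card {b \<in> A. f b = i}) = (\<Sum>i<a. card {b \<in> A. f b = i})"
    by (simp add: interv_sum_list_conv_sum_set_nat lessThan_atLeast0)
  also have "\<dots> = card (\<Union>i<a. {b \<in> A. f b = i})"
    using assms(1) by (intro card_UN_disjoint[symmetric]) auto
  also have "(\<Union>i<a. {b \<in> A. f b = i}) = A"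
    using assms(2) by auto
  finally show ?thesis .
qed

text \<open>The fibre of \<open>f\<close> over \<open>f d\<close> contains \<open>d\<close>. For a
  lower bound on the law of a shuffle, one deck that yields the given permutation is enough.\<close>

lemma pmf_le_pmf_map: "pmf p d \<le> pmf (map_pmf f p) (f d)"
proof -
  have "pmf p d = measure_pmf.prob p {d}"
    by (simp add: measure_pmf_single)
  also have "\<dots> \<le> measure_pmf.prob p (f -` {f d})"
    by (intro measure_pmf.finite_measure_mono) auto
  finally show ?thesis
    by (simp add: pmf_map)
qed

lemma perm_of_deck_map:
  assumes "w permutes {..<n}"
  shows   "perm_of_deck (map w [0..<n]) = w"
  using permutes_not_in[OF assms] by (auto simp: perm_of_deck_def fun_eq_iff)

lemma pmf_uniform_deck_ge:
  assumes "w permutes {..<n}"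
  shows   "1 / fact n \<le> pmf (map_pmf perm_of_deck (pmf_of_set (permutations_of_set {..<n}))) w"
proof -
  let ?d = "map w [0..<n]"
  have "?d \<in> permutations_of_set {..<n}"
    using permutes_image[OF assms] permutes_inj_on[OF assms]
    by (intro permutations_of_setI) (auto simp: distinct_map lessThan_atLeast0)
  then have "pmf (pmf_of_set (permutations_of_set {..<n})) ?d = 1 / fact n"
    by (subst pmf_of_set) auto
  with pmf_le_pmf_map[of "pmf_of_set (permutations_of_set {..<n})" ?d perm_of_deck]
  show ?thesis
    unfolding perm_of_deck_map[OF assms] by linarith
qed

text \<open>Of the \<open>a ^ n\<close> equally likely assignments,
  \<open>a * (a - 1) * ... * (a - n + 1)\<close> are injective; dividing factor by factor gives the
  product.\<close>

lemma prob_inj_on_boxes: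
  assumes "a \<ge> 1"
  shows   "measure_pmf.prob (Pi_pmf {..<n} d (\<lambda>_. pmf_of_set {..<a})) {f. inj_on f {..<n}} =
           (\<Prod>i = 1..n - 1. 1 - real i / real a)"
proof -
  \<comment> \<open>\<open>Pi_pmf\<close> lives on functions equal to \<open>d\<close> off
    \<open>{..<n}\<close>, while injections are counted among extensional functions. Restriction to
    \<open>{..<n}\<close> is a bijection between the two and preserves injectivity on
    \<open>{..<n}\<close>.\<close>
  let ?B = "PiE_dflt {..<n} d (\<lambda>_. {..<a})"
  let ?E = "{f \<in> {..<n} \<rightarrow>\<^sub>E {..<a}. inj_on f {..<n}}"
  have ne: "{..<a} \<noteq> {}"
    using assms by (auto simp: lessThan_empty_iff)
  have fin: "finite ?B" by auto
  have card_E: "card ?E = (\<Prod>i<n. a - i)"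
    using card_inj_on_subset_funcset[of "{..<n}" "{..<a}" "{..<n}"]
    by (simp add: lessThan_atLeast0)
  have image: "(\<lambda>h. restrict h {..<n}) ` (?B \<inter> {f. inj_on f {..<n}}) = ?E"
  proof -
    have "(\<lambda>h. restrict h {..<n}) ` (?B \<inter> {f. inj_on f {..<n}}) =
          (\<lambda>h. restrict h {..<n}) ` ?B \<inter> {f. inj_on f {..<n}}"
      by auto
    then show ?thesis
      by (auto simp: restrict_PiE_dflt)
  qed
  have "inj_on (\<lambda>h. restrict h {..<n}) ?B"
  proof (intro inj_onI ext)
    fix f g i
    assume f: "f \<in> ?B" and g: "g \<in> ?B" and eq: "restrict f {..<n} = restrict g {..<n}"
    show "f i = g i"
    proof (cases "i < n")
      case True
      then show ?thesis using fun_cong[OF eq, of i] by simp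
    next
      case False
      then show ?thesis using f g by (simp add: PiE_dflt_def)
    qed
  qed
  then have inj: "inj_on (\<lambda>h. restrict h {..<n}) (?B \<inter> {f. inj_on f {..<n}})"
    by (rule inj_on_subset) auto
 have card: "card (?B \<inter> {f. inj_on f {..<n}}) = (\<Prod>i<n. a - i)"
    using card_image[OF inj] unfolding image card_E by (rule sym)
  have "measure_pmf.prob (Pi_pmf {..<n} d (\<lambda>_. pmf_of_set {..<a})) {f. inj_on f {..<n}} =
        real (card (?B \<inter> {f. inj_on f {..<n}})) / real (card ?B)"
    using ne fin by (subst Pi_pmf_of_set) (simp_all add: measure_pmf_of_set)
  also have "\<dots> = real (\<Prod>i<n. a - i) / real a ^ n"
    unfolding card by (simp add: card_PiE_dflt)
  also have "\<dots> = (\<Prod>i<n. real (a - i) / real a)"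
    by (simp add: prod_dividef)
  also have "\<dots> = (\<Prod>i<n. 1 - real i / real a)"
  proof (cases "n \<le> a")
    case True
    show ?thesis
    proof (rule prod.cong)
      fix i assume "i \<in> {..<n}"
      with True have "i \<le> a" by simp
      then show "real (a - i) / real a = 1 - real i / real a"
        using assms by (simp add: of_nat_diff diff_divide_distrib)
    qed simp
  next
    \<comment> \<open>For \<open>i > a\<close> the factors differ, since natural subtraction
      truncates at 0. But now \<open>i = a\<close> is in range and contributes a zero factor to both
      products.\<close>
    case False
    then have "a \<in> {..<n}" by simp
    then have "(\<Prod>i<n. real (a - i) / real a) = 0"
      by (intro prod_zero bexI[of _ a]) simp_all
    moreover have "(\<Prod>i<n. 1 - real i / real a) = 0"
      using \<open>a \<in> {..<n}\<close> assms by (intro prod_zero bexI[of _ a]) simp_all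
    ultimately show ?thesis by (simp only:)
  qed
  \<comment> \<open>The only index dropped is 0, whose factor is 1; for \<open>n = 0\<close> both
    products are empty.\<close>
  also have "\<dots> = (\<Prod>i = 1..n - 1. 1 - real i / real a)"
    by (rule prod.mono_neutral_right) (auto simp: Suc_le_eq)
  finally show ?thesis .
qed

text \<open>Condition on the assignment of balls to boxes: injective assignments give each
  \<open>w\<close> mass at least \<open>1 / fact n\<close>, and the others are bounded below by
  0.\<close>

lemma pmf_x_shuffle_ge:
  assumes "length x \<ge> 1" "w permutes {..<n}"
  shows   "(\<Prod>i = 1..n - 1. 1 - real i / real (length x)) / fact n \<le> pmf (x_shuffle x n) w"
proof -
  define a where "a = length x"
  define M where "M = Pi_pmf {..<n} (0::nat) (\<lambda>_. pmf_of_set {..<a})"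
  define sizes where
    "sizes box = map (\<lambda>i. card {ball \<in> {..<n}. box ball = i}) [0..<a]" for box :: "nat \<Rightarrow> nat"
  define K where "K box = map_pmf perm_of_deck
      (pmf_of_set (interleavings (map2 orient x (cut_deck (sizes box) [0..<n]))))" for box
  have shuffle: "x_shuffle x n = bind_pmf M K"
    unfolding x_shuffle_def packet_sizes_def bind_map_pmf M_def K_def sizes_def a_def
      map_pmf_def[symmetric] ..
  have K_ge: "indicator {f. inj_on f {..<n}} box / fact n \<le> pmf (K box) w"
    if "box \<in> set_pmf M" for box
  proof (cases "inj_on box {..<n}")
    case True
    have "{..<a} \<noteq> {}"
      using assms(1) by (auto simp: a_def lessThan_empty_iff)
    then have "box ` {..<n} \<subseteq> {..<a}"
      using that by (auto simp: M_def set_Pi_pmf PiE_dflt_def)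
    then have "sum_list (sizes box) = n"
      using sum_card_fibres[of "{..<n}" box a] by (simp add: sizes_def)
    moreover have "m \<le> 1" if "m \<in> set (sizes box)" for m
      using that card_fibre_le_1[OF True] by (auto simp: sizes_def)
    ultimately have "K box = map_pmf perm_of_deck (pmf_of_set (permutations_of_set {..<n}))"
      using interleavings_singletons[of x "sizes box" n] by (simp add: K_def sizes_def a_def)
    then show ?thesis
      using pmf_uniform_deck_ge[OF assms(2)] True by simp
  qed simp
  have "(\<Prod>i = 1..n - 1. 1 - real i / real a) / fact n =
        (\<integral>box. indicator {f. inj_on f {..<n}} box / fact n \<partial>measure_pmf M)"
    using prob_inj_on_boxes[of a n 0] assms(1) by (simp add: M_def a_def)
  also have "\<dots> \<le> (\<integral>box. pmf (K box) w \<partial>measure_pmf M)"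
    \<comment> \<open>\<open>K_ge\<close> holds only on the support of \<open>M\<close>, hence the
      almost-everywhere form of monotonicity; both integrands lie between 0 and 1, so they are
      integrable.\<close>
    using K_ge
    by (intro integral_mono_AE measure_pmf.integrable_const_bound[where B = 1])
       (auto simp: AE_measure_pmf_iff pmf_le_1 indicator_def)
  also have "\<dots> = pmf (x_shuffle x n) w"
    by (simp add: shuffle pmf_bind)
  finally show ?thesis
    by (simp add: a_def)
qed

text \<open>Since \<open>U(w) = 1 / fact n\<close>, the ratio \<open>P(w) / U(w)\<close> is
  \<open>fact n * P(w)\<close>, and bounding every term bounds the maximum. The identity shows that
  \<open>perms n\<close> is nonempty, so that \<open>Max\<close> and \<open>pmf_of_set\<close> are
  meaningful.\<close>

lemma sep_leI:
  assumes "\<And>w. w permutes {..<n} \<Longrightarrow> p / fact n \<le> pmf P w"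
  shows   "sep n P \<le> 1 - p"
proof -
  have fin: "finite (perms n)"
    by (simp add: perms_def finite_permutations)
  have id: "id \<in> perms n"
    by (simp add: perms_def permutes_id)
  have "card (perms n) = fact n"
    by (simp add: perms_def card_permutations)
  then have "pmf (uniform_perm n) w = 1 / fact n" if "w \<in> perms n" for w
    using that fin id by (subst uniform_perm_def, subst pmf_of_set) auto
  moreover have "p \<le> pmf P w * fact n" if "w \<in> perms n" for w
    using assms[of w] that by (simp add: perms_def field_simps)
  ultimately show ?thesis
    unfolding sep_def using fin id by (subst Max_le_iff) auto
qed

theorem theorem4p4:
  fixes x :: "int list" and a n :: nat
  assumes "a \<ge> 1" and "length x = a" and "set x \<subseteq> {1, -1}"
  shows "sep n (x_shuffle x n) \<le> 1 - (\<Prod>i = 1..n - 1. 1 - real i / real a)"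
  using assms pmf_x_shuffle_ge[of x _ n] by (intro sep_leI) simp

end
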